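(* There exists an absolute constant $C > 0$ such that the following holds for any $\delta \in (0, 0.1)$. Fix an integer $L \ge 2$. Suppose that $$N \ge C \max\Big\{ L^2 d^{\frac{L}{L-1}} \log\frac{dL}{\delta},\ L^3 d \log\frac{L}{\delta}\Big\}.$$ Then it holds with probability at least $1 - \delta$ that $$\min_{u \in \mathcal{H} : \|u\|_\infty = 1} \|\hat\Sigma u\|_\infty \ge \frac{1}{2L}$$ and, as a result, $\|\hat\Sigma^\dagger\|_\infty \le 2L$.
   Context: $d, N$ are integers with $3 \le d \le N$; $e_i$ is the $i$th standard basis vector of $\mathbb{R}^d$; $\mathbf{1}$ is the all-ones vector; $\mathcal{H} = \{v \in \mathbb{R}^d : \mathbf{1}^\top v = 0\}$. The covariates are $x_r = e_{i_r} - e_{j_r}$, $r=1,\dots,N$, where the pairs $(i_r,j_r)_{r=1}^N$ are i.i.d. uniformly random in $\{(i,j): 1\le i<j\le d\}$. The sample covariance is $\hat\Sigma := \frac{d-1}{2N}\sum_{r=1}^N x_r x_r^\top$, viewed as a linear map $\mathcal{H}\to\mathcal{H}$ ($\mathcal{H}$ is invariant under $\hat\Sigma$), and $\hat\Sigma^\dagger$ is its pseudoinverse (the inverse of $\hat\Sigma$ on $\mathcal{H}$ when $\hat\Sigma$ is invertible on $\mathcal{H}$). For a linear map $A:\mathcal{H}\to\mathcal{H}$, $\|A\|_\infty := \max_{v\in\mathcal{H}:\|v\|_\infty=1}\|Av\|_\infty$. *)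

theory Defs
  imports "HOL-Probability.Product_PMF" "Jordan_Normal_Form.Matrix"
begin

no_notation inner (infix "\<bullet>" 70)
no_notation vec_nth (infixl "$" 90)

(* Vectors of R^d are "real vec"s in carrier_vec d, so that d can be quantified inside a formula.
   Their coordinates are numbered 0, ..., d - 1 and the observations 0, ..., N - 1. *)

definition centered :: "nat \<Rightarrow> real vec set" where
  "centered d = {v \<in> carrier_vec d. vec d (\<lambda>_. 1) \<bullet> v = 0}"

definition linf_norm :: "real vec \<Rightarrow> real" where
  "linf_norm v = Max ((\<lambda>i. \<bar>v $ i\<bar>) ` {..<dim_vec v})"

definition unit_centered :: "nat \<Rightarrow> real vec set" where
  "unit_centered d = {v \<in> centered d. linf_norm v = 1}"

(* For a linear map on the centered vectors and d >= 2, the supremum is a maximum and the infimum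
   below is a minimum, since the set unit_centered d is compact and nonempty. *)
definition linf_opnorm :: "nat \<Rightarrow> (real vec \<Rightarrow> real vec) \<Rightarrow> real" where
  "linf_opnorm d A = (SUP v \<in> unit_centered d. linf_norm (A v))"

definition linf_min_gain :: "nat \<Rightarrow> (real vec \<Rightarrow> real vec) \<Rightarrow> real" where
  "linf_min_gain d A = (INF v \<in> unit_centered d. linf_norm (A v))"

definition linear_on_centered :: "nat \<Rightarrow> (real vec \<Rightarrow> real vec) \<Rightarrow> bool" where
  "linear_on_centered d A \<longleftrightarrow>
     (\<forall>v \<in> centered d. A v \<in> centered d) \<and>
     (\<forall>u \<in> centered d. \<forall>v \<in> centered d. A (u + v) = A u + A v) \<and>
     (\<forall>c. \<forall>v \<in> centered d. A (c \<cdot>\<^sub>v v) = c \<cdot>\<^sub>v A v)"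

definition self_adjoint_on_centered :: "nat \<Rightarrow> (real vec \<Rightarrow> real vec) \<Rightarrow> bool" where
  "self_adjoint_on_centered d A \<longleftrightarrow>
     (\<forall>u \<in> centered d. \<forall>v \<in> centered d. A u \<bullet> v = u \<bullet> A v)"

(* The four Moore-Penrose conditions, for linear maps of the space of centered vectors to itself. *)
definition is_pseudoinverse :: "nat \<Rightarrow> (real vec \<Rightarrow> real vec) \<Rightarrow> (real vec \<Rightarrow> real vec) \<Rightarrow> bool" where
  "is_pseudoinverse d A B \<longleftrightarrow>
     linear_on_centered d B \<and>
     (\<forall>v \<in> centered d. A (B (A v)) = A v) \<and>
     (\<forall>v \<in> centered d. B (A (B v)) = B v) \<and>
     self_adjoint_on_centered d (A \<circ> B) \<and>
     self_adjoint_on_centered d (B \<circ> A)"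

(* The conditions determine B on the centered vectors only; extensionality makes B unique. *)
definition pseudoinverse :: "nat \<Rightarrow> (real vec \<Rightarrow> real vec) \<Rightarrow> real vec \<Rightarrow> real vec" where
  "pseudoinverse d A = (THE B. B \<in> extensional (centered d) \<and> is_pseudoinverse d A B)"

definition covariate :: "nat \<Rightarrow> nat \<times> nat \<Rightarrow> real vec" where
  "covariate d p = unit_vec d (fst p) - unit_vec d (snd p)"

definition sample_cov :: "nat \<Rightarrow> nat \<Rightarrow> (nat \<Rightarrow> nat \<times> nat) \<Rightarrow> real mat" where
  "sample_cov d N \<omega> = ((real d - 1) / (2 * real N)) \<cdot>\<^sub>m
     mat d d (\<lambda>(a, b). \<Sum>r<N. covariate d (\<omega> r) $ a * covariate d (\<omega> r) $ b)"

definition pairs :: "nat \<Rightarrow> (nat \<times> nat) set" where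
  "pairs d = {(i, j). i < j \<and> j < d}"

definition design :: "nat \<Rightarrow> nat \<Rightarrow> (nat \<Rightarrow> nat \<times> nat) pmf" where
  "design d N = Pi_pmf {..<N} (0, 0) (\<lambda>_. pmf_of_set (pairs d))"

end

theory Submission
  imports Defs "Jordan_Normal_Form.Determinant"
begin

text \<open>
  Regard the design as a random multigraph in which an edge has weight \<open>(d - 1) / (2 N)\<close>, so that
  \<open>\<Sigma>\<close> is its Laplacian and the expected weight between disjoint \<open>A\<close> and \<open>B\<close> is \<open>|A| |B| / d\<close>.
  Suppose that \<open>u\<close> attains its maximum norm with \<open>max u = 1\<close> and that \<open>\<Sigma> u < 1 / (2 L)\<close> everywhere.
  Summing \<open>\<Sigma> u\<close> over the level set \<open>S\<^sub>k = {u \<ge> 1 - k / L}\<close> leaves only the flow out of \<open>S\<^sub>k\<close>, and an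
  edge from \<open>S\<^sub>k\<close> to the outside of \<open>S\<^sub>k\<^sub>+\<^sub>1\<close> contributes at least \<open>1 / L\<close> times its weight; so these
  edges weigh less than \<open>|S\<^sub>k| / 2\<close>. The random graph permits this only if \<open>S\<^sub>k\<^sub>+\<^sub>1\<close> is larger than
  \<open>S\<^sub>k\<close> by the factor \<open>q = d powr (1 / (L - 1))\<close> or has at least \<open>d / 4\<close> elements, whence
  \<open>S = {u \<ge> 1 / L}\<close> has at least \<open>d / 4\<close> elements. All pairs of sets with \<open>|A| |B|\<close> of order
  \<open>d\<^sup>2 / L\<close> or more have nearly their expected cut weight. By the layer-cake formula the flow out of \<open>S\<close>
  is then at least half of its value \<open>sum u S \<ge> |S| / L\<close> in the expected graph, which contradicts
  \<open>\<Sigma> u < 1 / (2 L)\<close> on \<open>S\<close>.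
\<close>

subsection \<open>Flow out of the level sets of a potential\<close>

definition cut_weight :: "('a \<Rightarrow> 'a \<Rightarrow> real) \<Rightarrow> 'a set \<Rightarrow> 'a set \<Rightarrow> real" where
  "cut_weight W A B = (\<Sum>i\<in>A. \<Sum>j\<in>B. W i j)"

lemma cut_weight_nonneg:
  assumes "\<And>i j. W i j \<ge> 0"
  shows "cut_weight W A B \<ge> 0"
  unfolding cut_weight_def by (intro sum_nonneg assms)

text \<open>The terms \<open>W i j * (u i - u j)\<close> are antisymmetric in \<open>i\<close> and
  \<open>j\<close>, so those with both ends in \<open>S\<close> cancel and only edges leaving
  \<open>S\<close> remain.\<close>

lemma laplacian_sum_eq_flow:
  fixes W :: "'a \<Rightarrow> 'a \<Rightarrow> real"
  assumes "finite V" "S \<subseteq> V" and sym: "\<And>i j. W i j = W j i"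
  shows "(\<Sum>i\<in>S. \<Sum>j\<in>V. W i j * (u i - u j)) = (\<Sum>i\<in>S. \<Sum>j\<in>V - S. W i j * (u i - u j))"
proof -
  let ?X = "\<Sum>i\<in>S. \<Sum>j\<in>S. W i j * (u i - u j)"
  have "?X = (\<Sum>i\<in>S. \<Sum>j\<in>S. W j i * (u j - u i))"
    by (rule sum.swap)
  also have "\<dots> = (\<Sum>i\<in>S. \<Sum>j\<in>S. - (W i j * (u i - u j)))"
    by (intro sum.cong refl) (subst sym, simp add: algebra_simps)
  also have "\<dots> = - ?X"
    by (simp add: sum_negf)
  finally have "?X = 0" by simp
  moreover have "(\<Sum>j\<in>V. W i j * (u i - u j)) =
      (\<Sum>j\<in>V - S. W i j * (u i - u j)) + (\<Sum>j\<in>S. W i j * (u i - u j))" for i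
    using assms(1,2) by (rule sum.subset_diff[rotated])
  ultimately show ?thesis by (simp add: sum.distrib)
qed

text \<open>Each difference \<open>u i - u j\<close> is the integral over \<open>t\<close> of the
  indicator of \<open>u j < t \<le> u i\<close>. For fixed \<open>t\<close> the pairs counted form
  the product of a superlevel set of \<open>A\<close> and a sublevel set of \<open>B\<close>, so the
  hypothesis on cuts can be integrated over \<open>t\<close>. The slack \<open>m\<close> makes that
  hypothesis harmless for thin cuts and costs \<open>m\<close> per unit of length of the range of
  \<open>u\<close>.\<close>

lemma layer_cake_flow:
  fixes W :: "'a \<Rightarrow> 'a \<Rightarrow> real" and u :: "'a \<Rightarrow> real"
  assumes fin: "finite A" "finite B"
    and W: "\<And>i j. W i j \<ge> 0"
    and le: "\<And>i j. i \<in> A \<Longrightarrow> j \<in> B \<Longrightarrow> u j \<le> u i"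
    and ran: "\<And>i. i \<in> A \<Longrightarrow> u i \<le> h" "\<And>j. j \<in> B \<Longrightarrow> l \<le> u j"
    and "l \<le> h"
    and cut: "\<And>t. \<kappa> * (real (card {i \<in> A. t \<le> u i}) * real (card {j \<in> B. u j < t}) - m)
                 \<le> cut_weight W {i \<in> A. t \<le> u i} {j \<in> B. u j < t}"
  shows "\<kappa> * ((\<Sum>i\<in>A. \<Sum>j\<in>B. u i - u j) - m * (h - l)) \<le> (\<Sum>i\<in>A. \<Sum>j\<in>B. W i j * (u i - u j))"
proof -
  let ?I = "\<lambda>i j t. indicat_real {u j<..u i} t"
  let ?F = "\<lambda>t. \<Sum>i\<in>A. \<Sum>j\<in>B. W i j * ?I i j t"
  let ?G = "\<lambda>t. \<kappa> * ((\<Sum>i\<in>A. \<Sum>j\<in>B. ?I i j t) - m * indicat_real {l<..h} t)"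
  have int[simp]: "integrable lborel (indicat_real {a<..b})" for a b :: real
    by (cases "a \<le> b") (auto intro!: integrable_real_indicator)
  have len: "(LINT t|lborel. indicat_real {a<..b} t) = b - a" if "a \<le> b" for a b :: real
    using that by simp
  have level_sum: "(\<Sum>i\<in>A. \<Sum>j\<in>B. w i j * ?I i j t) = (\<Sum>i | i \<in> A \<and> t \<le> u i. \<Sum>j | j \<in> B \<and> u j < t. w i j)"
    for w :: "'a \<Rightarrow> 'a \<Rightarrow> real" and t
    using fin by (simp add: sum.inter_filter) (auto intro!: sum.cong simp: indicator_def)
  have pointwise: "?G t \<le> ?F t" for t
  proof (cases "t \<in> {l<..h}")
    case True
    have "(\<Sum>i\<in>A. \<Sum>j\<in>B. ?I i j t) = real (card {i \<in> A. t \<le> u i}) * real (card {j \<in> B. u j < t})"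
      using level_sum[of "\<lambda>_ _. 1"] by simp
    moreover have "?F t = cut_weight W {i \<in> A. t \<le> u i} {j \<in> B. u j < t}"
      using level_sum[of W] by (simp add: cut_weight_def)
    ultimately show ?thesis using True cut[of t] by simp
  next
    case False
    \<comment> \<open>No pair is separated at a level outside the range, so both sides vanish there
      and the slack is charged on \<open>{l<..h}\<close> only.\<close>
    have "?I i j t = 0" if "i \<in> A" "j \<in> B" for i j
      using False ran(1)[OF that(1)] ran(2)[OF that(2)] by (auto simp: indicator_def)
    then show ?thesis using False by simp
  qed
  have "\<kappa> * ((\<Sum>i\<in>A. \<Sum>j\<in>B. u i - u j) - m * (h - l)) = (LINT t|lborel. ?G t)"
    using le \<open>l \<le> h\<close> by (simp add: Bochner_Integration.integral_sum)
  also have "\<dots> \<le> (LINT t|lborel. ?F t)"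
    by (intro integral_mono pointwise) (auto intro!: Bochner_Integration.integrable_sum)
  also have "\<dots> = (\<Sum>i\<in>A. \<Sum>j\<in>B. W i j * (u i - u j))"
    using le by (simp add: Bochner_Integration.integral_sum)
  finally show ?thesis .
qed

text \<open>Induction over the levels. As long as the next level set stays below a quarter of the
  vertices, the small outflow contradicts \<open>expand\<close> unless the set has grown by more
  than the factor \<open>q\<close>; once a quarter is reached, the \<open>min\<close> holds by
  itself.\<close>

lemma superlevel_growth:
  fixes W :: "nat \<Rightarrow> nat \<Rightarrow> real" and u :: "nat \<Rightarrow> real" and L :: nat and q :: real
  assumes W: "\<And>i j. W i j \<ge> 0" and sym: "\<And>i j. W i j = W j i"
    and "finite V" and "i0 \<in> V" "u i0 = 1" and "L > 0" and "q > 0"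
    and expand: "\<And>S T. S \<subseteq> T \<Longrightarrow> T \<subseteq> V \<Longrightarrow> S \<noteq> {} \<Longrightarrow> real (card T) < real (card V) / 4 \<Longrightarrow>
        real (card T) \<le> q * real (card S) \<Longrightarrow> real (card S) / 2 \<le> cut_weight W S (V - T)"
    and small: "\<And>i. i \<in> V \<Longrightarrow> (\<Sum>j\<in>V. W i j * (u i - u j)) < 1 / (2 * real L)"
  shows "min (q ^ k) (real (card V) / 4) \<le> real (card {i \<in> V. 1 - real k / real L \<le> u i})"
proof (induction k)
  case 0
  have "card {i \<in> V. 1 \<le> u i} > 0"
    using assms(3-5) by (auto simp: card_gt_0_iff)
  then show ?case by simp
next
  case (Suc k)
  let ?S = "{i \<in> V. 1 - real k / real L \<le> u i}"
  let ?T = "{i \<in> V. 1 - real (Suc k) / real L \<le> u i}"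
  have "?S \<subseteq> ?T"
    using \<open>L > 0\<close> by (auto simp: field_simps)
  have "i0 \<in> ?S" using assms(4-6) by simp
  have cS: "card ?S > 0" using \<open>finite V\<close> \<open>i0 \<in> ?S\<close> by (auto simp: card_gt_0_iff)
  have fS: "finite ?S" "finite ?T" using \<open>finite V\<close> by auto
  show ?case
  proof (cases "real (card ?T) < real (card V) / 4")
    case True
    \<comment> \<open>Edges that skip the layer between \<open>?S\<close> and \<open>?T\<close> have
      a potential drop of at least \<open>1 / L\<close>.\<close>
    have "cut_weight W ?S (V - ?T) * (1 / real L) \<le> (\<Sum>i\<in>?S. \<Sum>j\<in>V - ?T. W i j * (u i - u j))"
      unfolding cut_weight_def sum_distrib_right
      by (intro sum_mono mult_left_mono W) (use \<open>L > 0\<close> in \<open>auto simp: field_simps\<close>)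
    \<comment> \<open>The added edges end in \<open>?T - ?S\<close>, below the threshold of
      \<open>?S\<close>, so their terms are nonnegative.\<close>
    also have "\<dots> \<le> (\<Sum>i\<in>?S. \<Sum>j\<in>V - ?S. W i j * (u i - u j))"
      by (intro sum_mono sum_mono2 mult_nonneg_nonneg W)
        (use \<open>?S \<subseteq> ?T\<close> \<open>finite V\<close> in auto)
    also have "\<dots> = (\<Sum>i\<in>?S. \<Sum>j\<in>V. W i j * (u i - u j))"
      by (rule laplacian_sum_eq_flow[symmetric]) (use \<open>finite V\<close> sym in auto)
    also have "\<dots> < (\<Sum>i\<in>?S. 1 / (2 * real L))"
      using \<open>i0 \<in> ?S\<close> \<open>finite V\<close> small by (intro sum_strict_mono) auto
    finally have "cut_weight W ?S (V - ?T) < real (card ?S) / 2"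
      using \<open>L > 0\<close> by (simp add: field_simps)
    then have "\<not> real (card ?T) \<le> q * real (card ?S)"
      using expand[OF \<open>?S \<subseteq> ?T\<close>] True \<open>i0 \<in> ?S\<close> by fastforce
    moreover have "card ?S \<le> card ?T" using \<open>?S \<subseteq> ?T\<close> fS by (intro card_mono)
    then have "q ^ k \<le> real (card ?S)" using Suc True by linarith
    then have "q * q ^ k \<le> q * real (card ?S)" using \<open>q > 0\<close> by (intro mult_left_mono) auto
    ultimately show ?thesis by simp
  qed simp
qed

lemma laplacian_gain_at_max:
  fixes W :: "nat \<Rightarrow> nat \<Rightarrow> real" and u :: "nat \<Rightarrow> real" and L d :: nat and q :: real
  assumes W: "\<And>i j. W i j \<ge> 0" and sym: "\<And>i j. W i j = W j i"
    and L: "L > 0" and q: "q > 0" "real d / 4 \<le> q ^ (L - 1)"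
    and expand: "\<And>S T. S \<subseteq> T \<Longrightarrow> T \<subseteq> {..<d} \<Longrightarrow> S \<noteq> {} \<Longrightarrow> real (card T) < real d / 4 \<Longrightarrow>
        real (card T) \<le> q * real (card S) \<Longrightarrow> real (card S) / 2 \<le> cut_weight W S ({..<d} - T)"
    and dense: "\<And>A B. A \<subseteq> {..<d} \<Longrightarrow> B \<subseteq> {..<d} \<Longrightarrow> A \<inter> B = {} \<Longrightarrow>
        (real d)\<^sup>2 / (24 * real L) \<le> real (card A) * real (card B) \<Longrightarrow>
        3 / 4 * (real (card A) * real (card B) / real d) \<le> cut_weight W A B"
    and zero: "(\<Sum>i<d. u i) = 0"
    and bnd: "\<And>i. i < d \<Longrightarrow> \<bar>u i\<bar> \<le> 1"
    and i0: "i0 < d" "u i0 = 1"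
  shows "\<exists>i<d. 1 / (2 * real L) \<le> (\<Sum>j<d. W i j * (u i - u j))"
proof (rule ccontr)
  assume "\<not> ?thesis"
  then have small: "(\<Sum>j<d. W i j * (u i - u j)) < 1 / (2 * real L)" if "i < d" for i
    using that by (auto simp: not_le)
  define S where "S = {i \<in> {..<d}. 1 / real L \<le> u i}"
  \<comment> \<open>The chain of level sets stops after \<open>L - 1\<close> steps, one short of
    level 0, which keeps \<open>u\<close> at least \<open>1 / L\<close> on \<open>S\<close>.\<close>
  have "1 - real (L - 1) / real L = 1 / real L"
    using L by (simp add: field_simps of_nat_diff)
  then have cS: "real d / 4 \<le> real (card S)"
    using superlevel_growth[of W "{..<d}" i0 u L q "L - 1"] assms small
    by (auto simp: S_def min_def split: if_splits)
  have S: "S \<subseteq> {..<d}" "finite S" by (auto simp: S_def)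
  have d: "d > 0" using i0 by simp
  have S_ne: "S \<noteq> {}" using cS d by auto
  have flow_less: "(\<Sum>i\<in>S. \<Sum>j\<in>{..<d} - S. W i j * (u i - u j)) < real (card S) / (2 * real L)"
  proof -
    have "(\<Sum>i\<in>S. \<Sum>j\<in>{..<d} - S. W i j * (u i - u j)) = (\<Sum>i\<in>S. \<Sum>j<d. W i j * (u i - u j))"
      by (rule laplacian_sum_eq_flow[symmetric]) (use S sym in auto)
    also have "\<dots> < (\<Sum>i\<in>S. 1 / (2 * real L))"
      using S S_ne small by (intro sum_strict_mono) auto
    finally show ?thesis by simp
  qed
  \<comment> \<open>This is the threshold of \<open>dense\<close>; for smaller products the bound
    with slack \<open>m\<close> has a nonpositive left side. Values of \<open>u\<close> range over
    an interval of length 2, so the slack costs \<open>3 / (4 * d) * (2 * m) = d / (16 * L)\<close>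
    in total.\<close>
  define m where "m = (real d)\<^sup>2 / (24 * real L)"
  have "m \<ge> 0" by (simp add: m_def)
  have layer: "3 / (4 * real d) * ((\<Sum>i\<in>S. \<Sum>j\<in>{..<d} - S. u i - u j) - m * (1 - (-1)))
      \<le> (\<Sum>i\<in>S. \<Sum>j\<in>{..<d} - S. W i j * (u i - u j))"
  proof (rule layer_cake_flow)
    fix t :: real
    let ?A = "{i \<in> S. t \<le> u i}" and ?B = "{j \<in> {..<d} - S. u j < t}"
    show "3 / (4 * real d) * (real (card ?A) * real (card ?B) - m) \<le> cut_weight W ?A ?B"
    proof (cases "m \<le> real (card ?A) * real (card ?B)")
      case True
      have "?A \<subseteq> {..<d}" "?B \<subseteq> {..<d}" "?A \<inter> ?B = {}" using S by auto
      note dense[OF this True[unfolded m_def]]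
      moreover have "3 / (4 * real d) * (real (card ?A) * real (card ?B) - m)
          \<le> 3 / (4 * real d) * (real (card ?A) * real (card ?B))"
        using \<open>m \<ge> 0\<close> by (intro mult_left_mono) auto
      ultimately show ?thesis by (simp add: field_simps)
    next
      case False
      then have "3 / (4 * real d) * (real (card ?A) * real (card ?B) - m) \<le> 0"
        by (intro mult_nonneg_nonpos) auto
      also have "\<dots> \<le> cut_weight W ?A ?B" by (intro cut_weight_nonneg W)
      finally show ?thesis .
    qed
  next
    fix i assume "i \<in> S" then show "u i \<le> 1" using bnd[of i] S by auto
  next
    fix j assume "j \<in> {..<d} - S" then show "- 1 \<le> u j" using bnd[of j] by auto
  next
    fix i j assume "i \<in> S" "j \<in> {..<d} - S" then show "u j \<le> u i" by (auto simp: S_def)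
  qed (use S W in auto)
  \<comment> \<open>This is the flow for constant weight 1; as \<open>u\<close> sums to zero, each
    vertex \<open>i\<close> of \<open>S\<close> contributes \<open>d * u i\<close>.\<close>
  have total: "(\<Sum>i\<in>S. \<Sum>j\<in>{..<d} - S. u i - u j) = real d * (\<Sum>i\<in>S. u i)"
  proof -
    have "(\<Sum>i\<in>S. \<Sum>j\<in>{..<d} - S. u i - u j) = (\<Sum>i\<in>S. \<Sum>j<d. 1 * (u i - u j))"
      using laplacian_sum_eq_flow[of "{..<d}" S "\<lambda>_ _. 1" u] S by simp
    also have "\<dots> = (\<Sum>i\<in>S. real d * u i)" by (simp add: sum_subtractf zero)
    finally show ?thesis by (simp add: sum_distrib_left)
  qed
  \<comment> \<open>In these terms the flow is at least \<open>3 / 4 * z - y / 4\<close> and less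
    than \<open>x / 2\<close>, which is impossible because \<open>y \<le> x \<le> z\<close>.\<close>
  define x y z where "x = real (card S) / real L" and "y = real d / (4 * real L)" and "z = (\<Sum>i\<in>S. u i)"
  have "x \<le> z"
    using sum_bounded_below[of S "1 / real L" u] by (auto simp: S_def x_def z_def)
  moreover have "y \<le> x"
    using cS L by (simp add: x_def y_def field_simps)
  moreover have "3 / (4 * real d) * (real d * (\<Sum>i\<in>S. u i) - m * (1 - (-1))) = 3 / 4 * z - y / 4"
    using d L by (simp add: m_def y_def z_def field_simps power2_eq_square)
  moreover have "real (card S) / (2 * real L) = x / 2" by (simp add: x_def)
  ultimately show False using layer flow_less unfolding total by linarith
qed

subsection \<open>Concentration\<close>

text \<open>Both orientations are included because \<open>pairs\<close> stores the smaller endpoint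
  first, whichever of the two sets it lies in.\<close>

definition crossing :: "'a set \<Rightarrow> 'a set \<Rightarrow> ('a \<times> 'a) set" where
  "crossing A B = A \<times> B \<union> B \<times> A"

text \<open>Markov's inequality for the exponential of minus a quarter of the count, whose
  expectation factors by independence. A lower bound \<open>x\<close> on the hit probability
  suffices, since more hits only make the lower tail lighter.\<close>

lemma chernoff_lower_tail:
  fixes p :: "'a pmf" and x :: real
  assumes "finite (set_pmf p)" and x: "x \<le> measure_pmf.prob p E"
  shows "measure_pmf.prob (Pi_pmf {..<N} dflt (\<lambda>_. p))
           {\<omega>. real (\<Sum>r<N. of_bool (\<omega> r \<in> E)) \<le> 3 / 4 * (real N * x)}
         \<le> exp (- real N * x / 32)" (is "measure_pmf.prob ?P ?B \<le> _")
proof -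
  let ?f = "\<lambda>v. exp (- of_bool (v \<in> E) / 4) :: real"
  let ?g = "\<lambda>\<omega>. \<Prod>r<N. ?f (\<omega> r)"
  let ?t = "exp (- 3 / 16 * (real N * x))"
  have g_eq: "?g \<omega> = exp (- real (\<Sum>r<N. of_bool (\<omega> r \<in> E)) / 4)" for \<omega>
  proof -
    have "- real (\<Sum>r<N. of_bool (\<omega> r \<in> E)) / 4 = (\<Sum>r<N. - of_bool (\<omega> r \<in> E) / 4)"
      by (simp only: of_nat_sum of_nat_of_bool sum_negf[symmetric] sum_divide_distrib)
    then show ?thesis by (simp only: exp_sum finite_lessThan)
  qed
  have E: "measure_pmf.expectation p ?f \<le> exp (- 7 / 32 * x)"
  proof -
    \<comment> \<open>One hit lowers the factor from 1 to at most \<open>1 - 7 / 32\<close>. The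
      threshold gives back \<open>3 / 4 * 1 / 4 = 6 / 32\<close>, so the exponent keeps
      \<open>1 / 32\<close> of \<open>N * x\<close>.\<close>
    have "exp (- (1 / 4 :: real)) \<le> 25 / 32"
    proof -
      have "32 / 25 \<le> 1 + 1 / 4 + (1 / 4 :: real)\<^sup>2 / 2" by (simp add: power2_eq_square)
      also have "\<dots> \<le> exp (1 / 4)" by (rule exp_lower_Taylor_quadratic) simp
      finally show ?thesis by (simp add: exp_minus field_simps)
    qed
    then have f: "?f v \<le> 1 - 7 / 32 * indicator E v" for v
      by (auto simp: indicator_def)
    have "measure_pmf.expectation p ?f \<le> measure_pmf.expectation p (\<lambda>v. 1 - 7 / 32 * indicator E v)"
      by (intro integral_mono f integrable_measure_pmf_finite assms)
    also have "\<dots> = 1 - 7 / 32 * measure_pmf.prob p E"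
      by (subst Bochner_Integration.integral_diff) (auto intro!: integrable_measure_pmf_finite assms)
    also have "\<dots> \<le> 1 + (- 7 / 32 * x)" using x by simp
    also have "\<dots> \<le> exp (- 7 / 32 * x)" by (rule exp_ge_add_one_self)
    finally show ?thesis .
  qed
  have "measure_pmf.prob ?P {\<omega> \<in> space ?P. ?t \<le> ?g \<omega>} \<le> measure_pmf.expectation ?P ?g / ?t"
  proof (rule integral_Markov_inequality_measure[where A = "{}"])
    have "finite (set_pmf ?P)"
      by (simp add: set_Pi_pmf) (intro finite_PiE_dflt, auto simp: assms)
    then show "integrable ?P ?g" by (rule integrable_measure_pmf_finite)
  qed (auto intro!: prod_nonneg)
  also have "{\<omega> \<in> space ?P. ?t \<le> ?g \<omega>} = ?B"
  proof -
    have "?t \<le> ?g \<omega> \<longleftrightarrow> real (\<Sum>r<N. of_bool (\<omega> r \<in> E)) \<le> 3 / 4 * (real N * x)" for \<omega>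
      unfolding g_eq exp_le_cancel_iff by (simp add: field_simps)
    then show ?thesis by simp
  qed
  also have "measure_pmf.expectation ?P ?g = measure_pmf.expectation p ?f ^ N"
    by (subst expectation_prod_Pi_pmf) (auto intro!: integrable_measure_pmf_finite assms)
  also have "\<dots> \<le> exp (- 7 / 32 * x) ^ N"
    by (intro power_mono E) simp
  also have "exp (- 7 / 32 * x) ^ N / ?t = exp (- real N * x / 32)"
    by (simp add: exp_of_nat_mult[symmetric] exp_diff[symmetric] field_simps)
  finally show ?thesis by (simp add: divide_right_mono)
qed

lemma finite_pairs: "finite (pairs d)"
  by (rule finite_subset[of _ "{..<d} \<times> {..<d}"]) (auto simp: pairs_def)

lemma card_pairs: "2 * real (card (pairs d)) = real d * (real d - 1)"
proof (induction d)
  case 0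
  then show ?case by (simp add: pairs_def)
next
  case (Suc d)
  have "pairs (Suc d) = pairs d \<union> {..<d} \<times> {d}" by (auto simp: pairs_def less_Suc_eq)
  moreover have "pairs d \<inter> {..<d} \<times> {d} = {}" by (auto simp: pairs_def)
  ultimately have "card (pairs (Suc d)) = card (pairs d) + d"
    by (simp add: card_Un_disjoint finite_pairs card_cartesian_product)
  then show ?case using Suc by (simp add: algebra_simps)
qed

lemma prob_crossing_ge:
  assumes "A \<subseteq> {..<d}" "B \<subseteq> {..<d}" "A \<inter> B = {}" "d \<ge> 2"
  shows "2 * (real (card A) * real (card B)) / (real d * (real d - 1))
           \<le> measure_pmf.prob (pmf_of_set (pairs d)) (crossing A B)"
proof -
  have "(0, 1) \<in> pairs d" using \<open>d \<ge> 2\<close> by (simp add: pairs_def)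
  then have ne: "pairs d \<noteq> {}" by blast
  \<comment> \<open>Sorting the endpoints sends \<open>A \<times> B\<close> into the crossing pairs,
    injectively because \<open>A\<close> and \<open>B\<close> are disjoint.\<close>
  let ?h = "\<lambda>(i, j). (min i j, max i j) :: nat \<times> nat"
  have "card (A \<times> B) = card (?h ` (A \<times> B))"
    by (rule card_image[symmetric]) (use assms(3) in \<open>auto simp: inj_on_def min_def max_def split: if_splits\<close>)
  also have "\<dots> \<le> card (pairs d \<inter> crossing A B)"
    by (intro card_mono finite_Int disjI1 finite_pairs)
       (use assms in \<open>force simp: pairs_def crossing_def min_def max_def le_less\<close>)
  finally have "real (card A * card B) \<le> real (card (pairs d \<inter> crossing A B))"
    by (simp add: card_cartesian_product del: of_nat_mult)
  moreover have "card (pairs d) > 0" using ne finite_pairs by (simp add: card_gt_0_iff)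
  ultimately show ?thesis
    unfolding measure_pmf_of_set[OF ne finite_pairs] card_pairs[symmetric]
    by (simp add: divide_right_mono)
qed

subsection \<open>Gain and pseudoinverse on the centered vectors\<close>

lemma centered_iff: "v \<in> centered d \<longleftrightarrow> v \<in> carrier_vec d \<and> (\<Sum>i<d. v $ i) = 0"
  by (auto simp: centered_def scalar_prod_def atLeast0LessThan)

lemma abs_le_linf_norm: "i < dim_vec v \<Longrightarrow> \<bar>v $ i\<bar> \<le> linf_norm v"
  unfolding linf_norm_def by (intro Max_ge) auto

lemma linf_norm_attained:
  assumes "dim_vec v > 0"
  obtains i where "i < dim_vec v" "\<bar>v $ i\<bar> = linf_norm v"
proof -
  have "linf_norm v \<in> (\<lambda>i. \<bar>v $ i\<bar>) ` {..<dim_vec v}"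
    unfolding linf_norm_def by (intro Max_in) (use assms in auto)
  then show ?thesis using that by auto
qed

lemma linf_norm_smult:
  assumes "dim_vec v > 0"
  shows "linf_norm (c \<cdot>\<^sub>v v) = \<bar>c\<bar> * linf_norm v"
proof (rule antisym)
  obtain i where i: "i < dim_vec v" "\<bar>v $ i\<bar> = linf_norm v"
    using linf_norm_attained[OF assms] .
  then show "\<bar>c\<bar> * linf_norm v \<le> linf_norm (c \<cdot>\<^sub>v v)"
    using abs_le_linf_norm[of i "c \<cdot>\<^sub>v v"] by (simp add: abs_mult)
  obtain j where "j < dim_vec (c \<cdot>\<^sub>v v)" "\<bar>(c \<cdot>\<^sub>v v) $ j\<bar> = linf_norm (c \<cdot>\<^sub>v v)"
    using linf_norm_attained[of "c \<cdot>\<^sub>v v"] assms by auto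
  then show "linf_norm (c \<cdot>\<^sub>v v) \<le> \<bar>c\<bar> * linf_norm v"
    using mult_left_mono[OF abs_le_linf_norm[of j v], of "\<bar>c\<bar>"] by (simp add: abs_mult)
qed

lemma linf_norm_pos:
  assumes "v \<in> carrier_vec d" "v \<noteq> 0\<^sub>v d"
  shows "linf_norm v > 0"
proof -
  obtain i where "i < d" "v $ i \<noteq> 0" using assms by (metis carrier_vecD eq_vecI index_zero_vec)
  then show ?thesis using abs_le_linf_norm[of i v] assms by auto
qed

lemma linf_norm_zero:
  assumes "d > 0"
  shows "linf_norm (0\<^sub>v d) = 0"
proof -
  obtain i where "i < dim_vec (0\<^sub>v d :: real vec)" "\<bar>0\<^sub>v d $ i\<bar> = linf_norm (0\<^sub>v d)"
    using linf_norm_attained[of "0\<^sub>v d"] assms by auto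
  then show ?thesis by simp
qed

lemma smult_centered: "v \<in> centered d \<Longrightarrow> c \<cdot>\<^sub>v v \<in> centered d"
  by (auto simp: centered_iff sum_distrib_left[symmetric])

lemma linf_norm_gain:
  assumes M: "M \<in> carrier_mat d d" "d > 0"
    and gain: "\<And>u. u \<in> unit_centered d \<Longrightarrow> \<eta> \<le> linf_norm (M *\<^sub>v u)"
    and u: "u \<in> centered d"
  shows "\<eta> * linf_norm u \<le> linf_norm (M *\<^sub>v u)"
proof -
  have uc: "u \<in> carrier_vec d" using u by (simp add: centered_iff)
  show ?thesis
  proof (cases "u = 0\<^sub>v d")
    case True
    have "M *\<^sub>v 0\<^sub>v d = 0\<^sub>v d" using M by auto
    then show ?thesis using True linf_norm_zero[OF \<open>d > 0\<close>] by simp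
  next
    case False
    then have pos: "linf_norm u > 0" using linf_norm_pos[OF uc] by simp
    let ?v = "(1 / linf_norm u) \<cdot>\<^sub>v u"
    have "?v \<in> unit_centered d"
      using u pos uc \<open>d > 0\<close> by (simp add: unit_centered_def smult_centered linf_norm_smult)
    from gain[OF this] have "\<eta> \<le> linf_norm ((1 / linf_norm u) \<cdot>\<^sub>v (M *\<^sub>v u))"
      using mult_mat_vec[OF M(1) uc] by simp
    also have "\<dots> = linf_norm (M *\<^sub>v u) / linf_norm u"
      using M pos by (subst linf_norm_smult) auto
    finally show ?thesis using pos by (simp add: field_simps)
  qed
qed

text \<open>Bounding the infimum in \<open>linf_min_gain\<close> and the supremum in
  \<open>linf_opnorm\<close> pointwise requires a nonempty index set.\<close>

lemma unit_centered_nonempty: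
  assumes "d \<ge> 2"
  shows "unit_centered d \<noteq> {}"
proof -
  let ?v = "unit_vec d 0 - unit_vec d 1 :: real vec"
  have 0: "?v \<in> centered d"
    using assms by (simp add: centered_iff unit_vec_def sum_subtractf)
  have "?v $ 0 = 1" using assms by simp
  then have "?v \<noteq> 0\<^sub>v d" using assms by (metis index_zero_vec(1) less_le_trans pos2 zero_neq_one)
  then have "linf_norm ?v > 0" by (intro linf_norm_pos) auto
  then have "(1 / linf_norm ?v) \<cdot>\<^sub>v ?v \<in> unit_centered d"
    using smult_centered[OF 0] assms unfolding unit_centered_def
    by (simp add: linf_norm_smult)
  then show ?thesis by blast
qed

text \<open>Adding the all-ones matrix turns a matrix that is injective on the centered vectors into one
  that is injective everywhere.\<close>

lemma surj_on_centered:
  fixes M :: "real mat"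
  assumes M: "M \<in> carrier_mat d d" "d > 0"
    and inv: "\<And>v. v \<in> carrier_vec d \<Longrightarrow> M *\<^sub>v v \<in> centered d"
    and inj: "\<And>v. v \<in> centered d \<Longrightarrow> M *\<^sub>v v = 0\<^sub>v d \<Longrightarrow> v = 0\<^sub>v d"
    and y: "y \<in> centered d"
  obtains x where "x \<in> centered d" "M *\<^sub>v x = y"
proof -
  let ?J = "mat d d (\<lambda>_. 1) :: real mat"
  let ?K = "M + ?J"
  have K: "?K \<in> carrier_mat d d" using M by simp
  have Kv: "(?K *\<^sub>v v) = M *\<^sub>v v + vec d (\<lambda>_. \<Sum>i<d. v $ i)" if "v \<in> carrier_vec d" for v
    using that M by (subst add_mult_distrib_mat_vec[of _ d d])
      (auto simp: scalar_prod_def atLeast0LessThan intro!: arg_cong2[where f = "(+)"])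
  \<comment> \<open>As \<open>M *\<^sub>v v\<close> is centered, the coordinates of
    \<open>?K *\<^sub>v v\<close> sum to \<open>d\<close> times the coordinate sum of
    \<open>v\<close>. This confines both kernel vectors of \<open>?K\<close> and preimages of
    centered vectors to \<open>centered d\<close>, where \<open>?K\<close> and \<open>M\<close>
    agree.\<close>
  have cen: "v \<in> centered d" if v: "v \<in> carrier_vec d" and "?K *\<^sub>v v \<in> centered d" for v
  proof -
    have "(\<Sum>i<d. (?K *\<^sub>v v) $ i) = (\<Sum>i<d. (M *\<^sub>v v) $ i) + real d * (\<Sum>i<d. v $ i)"
      unfolding Kv[OF v] using M by (simp add: sum.distrib)
    then show ?thesis using that inv[OF v] \<open>d > 0\<close> by (simp add: centered_iff)
  qed
  have KM: "?K *\<^sub>v v = M *\<^sub>v v" if "v \<in> centered d" for v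
  proof -
    have "vec d (\<lambda>_. 0) = (0\<^sub>v d :: real vec)" by auto
    then show ?thesis using Kv[of v] that M by (simp add: centered_iff)
  qed
  have "det ?K \<noteq> 0"
  proof
    assume "det ?K = 0"
    then obtain v where v: "v \<in> carrier_vec d" "v \<noteq> 0\<^sub>v d" "?K *\<^sub>v v = 0\<^sub>v d"
      using det_0_iff_vec_prod_zero[OF K] by auto
    moreover have "0\<^sub>v d \<in> centered d" by (simp add: centered_iff)
    ultimately show False using cen[OF v(1)] KM inj by metis
  qed
  let ?x = "(1 / det ?K) \<cdot>\<^sub>v (adj_mat ?K *\<^sub>v y)"
  have yc: "y \<in> carrier_vec d" using y by (simp add: centered_iff)
  have adj: "adj_mat ?K \<in> carrier_mat d d" "?K * adj_mat ?K = det ?K \<cdot>\<^sub>m 1\<^sub>m d"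
    using adj_mat[OF K] by auto
  have x: "?x \<in> carrier_vec d" using adj yc by auto
  have "?K *\<^sub>v ?x = (1 / det ?K) \<cdot>\<^sub>v ((?K * adj_mat ?K) *\<^sub>v y)"
    by (simp only: mult_mat_vec[OF K mult_mat_vec_carrier[OF adj(1) yc]]
        assoc_mult_mat_vec[OF K adj(1) yc])
  also have "\<dots> = y"
  proof -
    have "(det ?K \<cdot>\<^sub>m 1\<^sub>m d) *\<^sub>v y = det ?K \<cdot>\<^sub>v y" using yc by auto
    then show ?thesis unfolding adj using yc \<open>det ?K \<noteq> 0\<close> by (simp add: smult_smult_assoc)
  qed
  finally have "?K *\<^sub>v ?x = y" .
  then show ?thesis using that[of ?x] cen[OF x] y KM by auto
qed

text \<open>Injectivity on the centered vectors yields a genuine inverse there. Both compositions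
  are then the identity, so the Penrose conditions hold, and the definite description in
  \<open>pseudoinverse\<close> selects this inverse once uniqueness is shown.\<close>

lemma pseudoinverse_right_inverse:
  fixes M :: "real mat"
  assumes M: "M \<in> carrier_mat d d" "d > 0"
    and inv: "\<And>v. v \<in> carrier_vec d \<Longrightarrow> M *\<^sub>v v \<in> centered d"
    and inj: "\<And>v. v \<in> centered d \<Longrightarrow> M *\<^sub>v v = 0\<^sub>v d \<Longrightarrow> v = 0\<^sub>v d"
    and v: "v \<in> centered d"
  shows "pseudoinverse d (\<lambda>u. M *\<^sub>v u) v \<in> centered d" "M *\<^sub>v pseudoinverse d (\<lambda>u. M *\<^sub>v u) v = v"
proof -
  let ?A = "\<lambda>u. M *\<^sub>v u"
  let ?H = "centered d"
  have cv: "x \<in> carrier_vec d" if "x \<in> ?H" for x using that by (simp add: centered_iff)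
  have A_in: "?A x \<in> ?H" if "x \<in> ?H" for x using inv cv that by blast
  have eq: "x = y" if "x \<in> ?H" "y \<in> ?H" "?A x = ?A y" for x y
  proof -
    have "x - y \<in> ?H" using that by (auto simp: centered_iff sum_subtractf)
    moreover have "?A (x - y) = 0\<^sub>v d"
      using that M cv by (auto simp: mult_minus_distrib_mat_vec[of _ d d])
    ultimately have "x - y = 0\<^sub>v d" by (rule inj)
    then have "(x - y) $ i = 0" if "i < d" for i using that by simp
    then show ?thesis
      using cv[OF that(1)] cv[OF that(2)] by (intro eq_vecI) auto
  qed
  \<comment> \<open>The restriction makes \<open>B\<close> extensional, as the definition of
    \<open>pseudoinverse\<close> demands.\<close>
  define B where "B = restrict (\<lambda>y. SOME x. x \<in> ?H \<and> ?A x = y) ?H"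
  have B: "B y \<in> ?H" "?A (B y) = y" if "y \<in> ?H" for y
  proof -
    have "\<exists>x. x \<in> ?H \<and> ?A x = y" using surj_on_centered[OF M inv inj that] by blast
    from someI_ex[OF this] show "B y \<in> ?H" "?A (B y) = y" using that by (auto simp: B_def)
  qed
  have BA: "B (?A x) = x" if "x \<in> ?H" for x
    using A_in[OF that] by (intro eq[OF B(1) that B(2)])
  have add_in: "x + y \<in> ?H" if "x \<in> ?H" "y \<in> ?H" for x y
    using that by (auto simp: centered_iff sum.distrib)
  have "linear_on_centered d B"
    unfolding linear_on_centered_def
  proof (intro conjI ballI allI)
    fix x y assume xy: "x \<in> ?H" "y \<in> ?H"
    have "?A (B x + B y) = x + y"
      using xy B cv M by (simp add: mult_add_distrib_mat_vec[of _ d d])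
    then show "B (x + y) = B x + B y"
      using xy B add_in by - (rule eq, auto)
  next
    fix c x assume x: "x \<in> ?H"
    have "?A (c \<cdot>\<^sub>v B x) = c \<cdot>\<^sub>v x"
      using x B cv M by (simp add: mult_mat_vec[of _ d d])
    then show "B (c \<cdot>\<^sub>v x) = c \<cdot>\<^sub>v B x"
      using x B smult_centered by - (rule eq, auto)
  qed (use B in blast)
  then have "is_pseudoinverse d ?A B"
    unfolding is_pseudoinverse_def self_adjoint_on_centered_def using B BA A_in by simp
  moreover have "B \<in> extensional ?H" by (simp add: B_def)
  moreover have "B' = B" if "B' \<in> extensional ?H" "is_pseudoinverse d ?A B'" for B'
  proof (rule extensionalityI[OF that(1) \<open>B \<in> extensional ?H\<close>])
    fix y assume y: "y \<in> ?H"
    \<comment> \<open>The first Penrose condition at \<open>B y\<close> says that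
      \<open>?A (B' y) = y\<close>; injectivity of \<open>?A\<close> then identifies
      \<open>B' y\<close> with \<open>B y\<close>.\<close>
    have "B' y \<in> ?H" "?A (B' (?A (B y))) = ?A (B y)"
      using that(2) B[OF y] y by (auto simp: is_pseudoinverse_def linear_on_centered_def)
    then show "B' y = B y" using B[OF y] by - (rule eq, auto)
  qed
  ultimately have "pseudoinverse d ?A = B"
    unfolding pseudoinverse_def by - (rule the_equality, blast+)
  then show "pseudoinverse d ?A v \<in> ?H" "?A (pseudoinverse d ?A v) = v"
    using B v by auto
qed

text \<open>For a unit vector \<open>v\<close> with pseudoinverse image \<open>w\<close>, the gain
  bound at \<open>w\<close> reads \<open>\<eta> * linf_norm w \<le> linf_norm (M *\<^sub>v w) =
  linf_norm v = 1\<close>.\<close>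

lemma linf_opnorm_pseudoinverse_le:
  fixes M :: "real mat"
  assumes M: "M \<in> carrier_mat d d" "d \<ge> 2" and "\<eta> > 0"
    and inv: "\<And>v. v \<in> carrier_vec d \<Longrightarrow> M *\<^sub>v v \<in> centered d"
    and gain: "\<And>u. u \<in> unit_centered d \<Longrightarrow> \<eta> \<le> linf_norm (M *\<^sub>v u)"
  shows "linf_opnorm d (pseudoinverse d (\<lambda>u. M *\<^sub>v u)) \<le> 1 / \<eta>"
  unfolding linf_opnorm_def
proof (rule cSUP_least)
  have "d > 0" using \<open>d \<ge> 2\<close> by simp
  have gain': "\<eta> * linf_norm u \<le> linf_norm (M *\<^sub>v u)" if "u \<in> centered d" for u
    using linf_norm_gain[OF M(1) \<open>d > 0\<close> gain that] .
  have inj: "v = 0\<^sub>v d" if "v \<in> centered d" "M *\<^sub>v v = 0\<^sub>v d" for v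
    using gain'[OF that(1)] linf_norm_pos[of v d] that \<open>\<eta> > 0\<close> linf_norm_zero[OF \<open>d > 0\<close>]
    by (auto simp: centered_iff mult_le_0_iff)
  fix v assume v: "v \<in> unit_centered d"
  then have vc: "v \<in> centered d" by (simp add: unit_centered_def)
  let ?w = "pseudoinverse d (\<lambda>u. M *\<^sub>v u) v"
  have w: "?w \<in> centered d" "M *\<^sub>v ?w = v"
    by (rule pseudoinverse_right_inverse[OF M(1) \<open>d > 0\<close> inv inj vc]; assumption)+
  have "\<eta> * linf_norm ?w \<le> 1"
    using gain'[OF w(1)] v unfolding w(2) by (simp add: unit_centered_def)
  then show "linf_norm ?w \<le> 1 / \<eta>" using \<open>\<eta> > 0\<close> by (simp add: field_simps)
qed (rule unit_centered_nonempty[OF \<open>d \<ge> 2\<close>])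

section \<open>The sample covariance as the Laplacian of a random multigraph\<close>

text \<open>The prefactor is that of \<open>sample_cov\<close>; under \<open>design\<close>, two
  distinct vertices below \<open>d\<close> then have expected weight \<open>1 / d\<close>.\<close>

definition edge_weight :: "nat \<Rightarrow> nat \<Rightarrow> (nat \<Rightarrow> nat \<times> nat) \<Rightarrow> nat \<Rightarrow> nat \<Rightarrow> real" where
  "edge_weight d N \<omega> i j = (real d - 1) / (2 * real N) * (\<Sum>r<N. of_bool (\<omega> r \<in> crossing {i} {j}))"

lemma edge_weight_nonneg: "d > 0 \<Longrightarrow> edge_weight d N \<omega> i j \<ge> 0"
  unfolding edge_weight_def by (intro mult_nonneg_nonneg sum_nonneg) auto

lemma edge_weight_sym: "edge_weight d N \<omega> i j = edge_weight d N \<omega> j i"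
  by (simp add: edge_weight_def crossing_def Un_commute)

text \<open>Since \<open>A\<close> and \<open>B\<close> are disjoint, a pair in
  \<open>crossing A B\<close> lies in \<open>crossing {i} {j}\<close> for exactly one
  \<open>(i, j)\<close> in \<open>A \<times> B\<close>.\<close>

lemma cut_weight_edge_weight:
  assumes "finite A" "finite B" "A \<inter> B = {}"
  shows "cut_weight (edge_weight d N \<omega>) A B =
           (real d - 1) / (2 * real N) * (\<Sum>r<N. of_bool (\<omega> r \<in> crossing A B))"
proof -
  have "(\<Sum>i\<in>A. \<Sum>j\<in>B. of_bool (p \<in> crossing {i} {j})) = (of_bool (p \<in> crossing A B) :: real)" for p
  proof -
    have "(\<Sum>i\<in>A. \<Sum>j\<in>B. of_bool (p \<in> crossing {i} {j})) =
       (\<Sum>i\<in>A. \<Sum>j\<in>B. of_bool (fst p = i) * of_bool (snd p = j) + of_bool (snd p = i) * of_bool (fst p = j) :: real)"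
      by (intro sum.cong refl) (use assms(3) in \<open>auto simp: crossing_def of_bool_def\<close>)
    also have "\<dots> = of_bool (fst p \<in> A) * of_bool (snd p \<in> B) + of_bool (snd p \<in> A) * of_bool (fst p \<in> B)"
      using assms(1,2) by (simp add: sum.distrib sum_product[symmetric] of_bool_def)
    also have "\<dots> = of_bool (p \<in> crossing A B)"
      using assms(3) by (cases p) (auto simp: crossing_def of_bool_def)
    finally show ?thesis .
  qed
  note * = this
  have "cut_weight (edge_weight d N \<omega>) A B = (real d - 1) / (2 * real N) *
     (\<Sum>i\<in>A. \<Sum>j\<in>B. \<Sum>r<N. of_bool (\<omega> r \<in> crossing {i} {j}))"
    unfolding cut_weight_def edge_weight_def sum_distrib_left ..
  also have "(\<Sum>i\<in>A. \<Sum>j\<in>B. \<Sum>r<N. of_bool (\<omega> r \<in> crossing {i} {j})) =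
      (\<Sum>r<N. \<Sum>i\<in>A. \<Sum>j\<in>B. of_bool (\<omega> r \<in> crossing {i} {j}) :: real)"
    by (subst (2) sum.swap, subst sum.swap) (rule refl)
  finally show ?thesis unfolding * .
qed

lemma sample_cov_carrier: "sample_cov d N \<omega> \<in> carrier_mat d d"
  by (simp add: sample_cov_def)

text \<open>The rank-one matrix of a single observation \<open>(k, l)\<close> is the Laplacian of
  one edge: it sends \<open>u\<close> to \<open>u $ k - u $ l\<close> times the covariate. Summing
  over observations adds up the edge weights.\<close>

lemma sample_cov_mult_eq_laplacian:
  assumes \<omega>: "\<And>r. r < N \<Longrightarrow> \<omega> r \<in> pairs d" and u: "u \<in> carrier_vec d" and i: "i < d"
  shows "(sample_cov d N \<omega> *\<^sub>v u) $ i = (\<Sum>j<d. edge_weight d N \<omega> i j * (u $ i - u $ j))"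
proof -
  let ?c = "(real d - 1) / (2 * real N)"
  have edge: "(\<Sum>j<d. covariate d p $ i * covariate d p $ j * u $ j) =
      (\<Sum>j<d. of_bool (p \<in> crossing {i} {j}) * (u $ i - u $ j))" if p: "p \<in> pairs d" for p
  proof -
    obtain k l where kl: "p = (k, l)" "k < d" "l < d" "k \<noteq> l"
      using p by (auto simp: pairs_def)
    have cov: "covariate d p $ j = of_bool (j = k) - of_bool (j = l)" if "j < d" for j
      using that kl by (auto simp: covariate_def unit_vec_def)
    have "(\<Sum>j<d. covariate d p $ i * covariate d p $ j * u $ j) =
        (of_bool (i = k) - of_bool (i = l)) * (\<Sum>j<d. (of_bool (j = k) - of_bool (j = l)) * u $ j)"
      unfolding sum_distrib_left by (intro sum.cong) (auto simp: cov i)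
    also have "(\<Sum>j<d. (of_bool (j = k) - of_bool (j = l)) * u $ j) = u $ k - u $ l"
      using kl by (simp add: left_diff_distrib sum_subtractf)
    also have "(of_bool (i = k) - of_bool (i = l)) * (u $ k - u $ l) =
      of_bool (i = k) * (u $ i - u $ l) + of_bool (i = l) * (u $ i - u $ k)"
      by (auto simp: of_bool_def)
    also have "\<dots> = (\<Sum>j<d. of_bool (i = k) * (of_bool (j = l) * (u $ i - u $ j))
        + of_bool (i = l) * (of_bool (j = k) * (u $ i - u $ j)))"
      using kl by (simp add: sum.distrib sum_distrib_left[symmetric])
    also have "\<dots> = (\<Sum>j<d. of_bool (p \<in> crossing {i} {j}) * (u $ i - u $ j))"
      by (intro sum.cong refl) (use kl in \<open>auto simp: crossing_def of_bool_def\<close>)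
    finally show ?thesis .
  qed
  have "(sample_cov d N \<omega> *\<^sub>v u) $ i =
      (\<Sum>j<d. ?c * (\<Sum>r<N. covariate d (\<omega> r) $ i * covariate d (\<omega> r) $ j) * u $ j)"
    using i u by (simp add: sample_cov_def scalar_prod_def atLeast0LessThan)
  also have "\<dots> = (\<Sum>j<d. \<Sum>r<N. ?c * (covariate d (\<omega> r) $ i * covariate d (\<omega> r) $ j * u $ j))"
    by (simp add: sum_distrib_left sum_distrib_right mult_ac)
  also have "\<dots> = (\<Sum>r<N. ?c * (\<Sum>j<d. covariate d (\<omega> r) $ i * covariate d (\<omega> r) $ j * u $ j))"
    by (subst sum.swap) (simp add: sum_distrib_left)
  also have "\<dots> = (\<Sum>r<N. ?c * (\<Sum>j<d. of_bool (\<omega> r \<in> crossing {i} {j}) * (u $ i - u $ j)))"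
    using edge \<omega> by (intro sum.cong refl) auto
  also have "\<dots> = (\<Sum>j<d. \<Sum>r<N. ?c * (of_bool (\<omega> r \<in> crossing {i} {j}) * (u $ i - u $ j)))"
    unfolding sum_distrib_left by (rule sum.swap)
  also have "\<dots> = (\<Sum>j<d. edge_weight d N \<omega> i j * (u $ i - u $ j))"
    unfolding edge_weight_def sum_distrib_left sum_distrib_right
    by (intro sum.cong refl) (rule mult.assoc[symmetric])
  finally show ?thesis .
qed

text \<open>The coordinate sum is the flow out of the whole vertex set, which no edge
  leaves.\<close>

lemma sample_cov_mult_centered:
  assumes "\<And>r. r < N \<Longrightarrow> \<omega> r \<in> pairs d" "u \<in> carrier_vec d"
  shows "sample_cov d N \<omega> *\<^sub>v u \<in> centered d"
proof -
  have "(\<Sum>i<d. (sample_cov d N \<omega> *\<^sub>v u) $ i) = (\<Sum>i<d. \<Sum>j<d. edge_weight d N \<omega> i j * (u $ i - u $ j))"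
    using sample_cov_mult_eq_laplacian[OF assms] by simp
  also have "\<dots> = 0"
    by (subst laplacian_sum_eq_flow) (auto intro: edge_weight_sym)
  finally show ?thesis
    using mult_mat_vec_carrier[OF sample_cov_carrier assms(2)] unfolding centered_iff by blast
qed

lemma linf_norm_sample_cov_ge:
  assumes \<omega>: "\<And>r. r < N \<Longrightarrow> \<omega> r \<in> pairs d"
    and L: "L > 0" and q: "q > 0" "real d / 4 \<le> q ^ (L - 1)"
    and expand: "\<And>S T. S \<subseteq> T \<Longrightarrow> T \<subseteq> {..<d} \<Longrightarrow> S \<noteq> {} \<Longrightarrow> real (card T) < real d / 4 \<Longrightarrow>
        real (card T) \<le> q * real (card S) \<Longrightarrow>
        real (card S) / 2 \<le> cut_weight (edge_weight d N \<omega>) S ({..<d} - T)"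
    and dense: "\<And>A B. A \<subseteq> {..<d} \<Longrightarrow> B \<subseteq> {..<d} \<Longrightarrow> A \<inter> B = {} \<Longrightarrow>
        (real d)\<^sup>2 / (24 * real L) \<le> real (card A) * real (card B) \<Longrightarrow>
        3 / 4 * (real (card A) * real (card B) / real d) \<le> cut_weight (edge_weight d N \<omega>) A B"
    and "d > 0" and u: "u \<in> unit_centered d"
  shows "1 / (2 * real L) \<le> linf_norm (sample_cov d N \<omega> *\<^sub>v u)"
proof -
  have uc: "u \<in> carrier_vec d" and zero: "(\<Sum>i<d. u $ i) = 0" and norm: "linf_norm u = 1"
    using u by (auto simp: unit_centered_def centered_iff)
  obtain i0 where i0: "i0 < d" "\<bar>u $ i0\<bar> = 1"
    using linf_norm_attained[of u] uc norm \<open>d > 0\<close> by auto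
  have bnd: "\<bar>u $ i\<bar> \<le> 1" if "i < d" for i
    using abs_le_linf_norm[of i u] that uc norm by simp
  let ?W = "edge_weight d N \<omega>"
  \<comment> \<open>A coordinate of largest modulus may be -1. Multiplying \<open>u\<close> by this
    sign turns it into a maximum equal to 1 and changes neither centering nor absolute
    values.\<close>
  let ?s = "u $ i0"
  have s: "?s * ?s = 1" "\<bar>?s\<bar> = 1" using i0 by (auto simp: abs_if split: if_splits)
  have "\<exists>i<d. 1 / (2 * real L) \<le> (\<Sum>j<d. ?W i j * (?s * u $ i - ?s * u $ j))"
    by (rule laplacian_gain_at_max[where q = q and ?i0.0 = i0])
      (use L q expand dense bnd i0 s zero \<open>d > 0\<close> in
        \<open>auto simp: edge_weight_nonneg edge_weight_sym abs_mult sum_distrib_left[symmetric]\<close>)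
  then obtain i where i: "i < d" "1 / (2 * real L) \<le> (\<Sum>j<d. ?W i j * (?s * u $ i - ?s * u $ j))"
    by blast
  have "(\<Sum>j<d. ?W i j * (?s * u $ i - ?s * u $ j)) = ?s * (sample_cov d N \<omega> *\<^sub>v u) $ i"
    by (subst sample_cov_mult_eq_laplacian)
      (use \<omega> uc i(1) in \<open>auto simp: sum_distrib_left algebra_simps\<close>)
  also have "\<dots> \<le> \<bar>(sample_cov d N \<omega> *\<^sub>v u) $ i\<bar>"
    using abs_ge_self[of "?s * (sample_cov d N \<omega> *\<^sub>v u) $ i"] s(2) by (simp only: abs_mult mult_1)
  also have "\<dots> \<le> linf_norm (sample_cov d N \<omega> *\<^sub>v u)"
    using i(1) by (intro abs_le_linf_norm) (simp add: sample_cov_def)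
  finally show ?thesis using i(2) by simp
qed

section \<open>Union bounds for expansion and for dense cuts\<close>

text \<open>With \<open>?x\<close> the lower bound on the crossing probability,
  \<open>(d - 1) / (2 * N)\<close> times \<open>N * ?x\<close> is
  \<open>card A * card B / d\<close>, so the event is a lower tail of the crossing count. The
  exponent is weakened at the end by replacing \<open>d * (d - 1)\<close> with the square of
  \<open>d\<close>.\<close>

lemma prob_cut_weight_less:
  assumes AB: "A \<subseteq> {..<d}" "B \<subseteq> {..<d}" "A \<inter> B = {}" and d: "d \<ge> 2" and "N > 0"
  shows "measure_pmf.prob (design d N)
      {\<omega>. cut_weight (edge_weight d N \<omega>) A B < 3 / 4 * (real (card A) * real (card B) / real d)}
    \<le> exp (- (real N * (real (card A) * real (card B)) / (16 * (real d)\<^sup>2)))"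
proof -
  let ?ab = "real (card A) * real (card B)"
  let ?x = "2 * ?ab / (real d * (real d - 1))"
  have fin: "finite A" "finite B" using AB(1,2) by (auto intro: finite_subset)
  have "(0, 1) \<in> pairs d" using d by (simp add: pairs_def)
  then have "finite (set_pmf (pmf_of_set (pairs d)))"
    using finite_pairs[of d] by (subst set_pmf_of_set) auto
  note tail = chernoff_lower_tail[OF this prob_crossing_ge[OF AB d]]
  have "measure_pmf.prob (design d N) {\<omega>. cut_weight (edge_weight d N \<omega>) A B < 3 / 4 * (?ab / real d)}
    \<le> measure_pmf.prob (design d N) {\<omega>. real (\<Sum>r<N. of_bool (\<omega> r \<in> crossing A B)) \<le> 3 / 4 * (real N * ?x)}"
  proof (intro measure_pmf.finite_measure_mono subsetI CollectI)
    fix \<omega> assume "\<omega> \<in> {\<omega>. cut_weight (edge_weight d N \<omega>) A B < 3 / 4 * (?ab / real d)}"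
    then have *: "(real d - 1) / (2 * real N) * real (\<Sum>r<N. of_bool (\<omega> r \<in> crossing A B)) < 3 / 4 * (?ab / real d)"
      by (simp add: cut_weight_edge_weight[OF fin AB(3)])
    have "real d - 1 > 0" using d by simp
    with * show "real (\<Sum>r<N. of_bool (\<omega> r \<in> crossing A B)) \<le> 3 / 4 * (real N * ?x)"
      using d \<open>N > 0\<close> by (simp add: field_simps)
  qed simp
  also have "\<dots> \<le> exp (- real N * ?x / 32)"
    unfolding design_def by (rule tail)
  also have "\<dots> \<le> exp (- (real N * ?ab / (16 * (real d)\<^sup>2)))"
  proof -
    have "real N * ?ab / (16 * (real d)\<^sup>2) \<le> real N * ?ab / (16 * (real d * (real d - 1)))"
      using d by (intro divide_left_mono mult_pos_pos mult_left_mono) (auto simp: power2_eq_square)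
    then show ?thesis by simp
  qed
  finally show ?thesis .
qed

lemma prob_union_le:
  assumes "finite I" and "\<And>i. i \<in> I \<Longrightarrow> measure_pmf.prob P {\<omega>. E i \<omega>} \<le> f i"
  shows "measure_pmf.prob P {\<omega>. \<exists>i\<in>I. E i \<omega>} \<le> sum f I"
proof -
  have "{\<omega>. \<exists>i\<in>I. E i \<omega>} = (\<Union>i\<in>I. {\<omega>. E i \<omega>})" by auto
  also have "measure_pmf.prob P \<dots> \<le> (\<Sum>i\<in>I. measure_pmf.prob P {\<omega>. E i \<omega>})"
    using assms(1) by (intro measure_UNION_le) auto
  also have "\<dots> \<le> sum f I" using assms(2) by (rule sum_mono)
  finally show ?thesis .
qed

text \<open>Expanding the product of \<open>1 + y\<close> over \<open>V\<close>, each subset records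
  the factors that contribute \<open>y\<close>.\<close>

lemma sum_power_card_Pow:
  fixes y :: real
  assumes "finite V"
  shows "(\<Sum>T\<in>Pow V. y ^ card T) = (1 + y) ^ card V"
  using prod_add[OF assms, of "\<lambda>_. y" "\<lambda>_. 1"] by (simp add: add.commute)

definition expanding :: "real \<Rightarrow> nat \<Rightarrow> (nat \<Rightarrow> nat \<Rightarrow> real) \<Rightarrow> bool" where
  "expanding q d W \<longleftrightarrow> (\<forall>S T. S \<subseteq> T \<longrightarrow> T \<subseteq> {..<d} \<longrightarrow> S \<noteq> {} \<longrightarrow> real (card T) < real d / 4 \<longrightarrow>
     real (card T) \<le> q * real (card S) \<longrightarrow> real (card S) / 2 \<le> cut_weight W S ({..<d} - T))"

definition dense_cuts :: "real \<Rightarrow> nat \<Rightarrow> (nat \<Rightarrow> nat \<Rightarrow> real) \<Rightarrow> bool" where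
  "dense_cuts m d W \<longleftrightarrow> (\<forall>A B. A \<subseteq> {..<d} \<longrightarrow> B \<subseteq> {..<d} \<longrightarrow> A \<inter> B = {} \<longrightarrow>
     m \<le> real (card A) * real (card B) \<longrightarrow>
     3 / 4 * (real (card A) * real (card B) / real d) \<le> cut_weight W A B)"

text \<open>Union bound over pairs \<open>S \<subseteq> T\<close>. The condition
  \<open>card T \<le> q * card S\<close> turns the tail for \<open>S\<close> into a power of
  \<open>exp (- K)\<close> with exponent \<open>card T\<close>, small enough to pay for the choice
  of both sets.\<close>

lemma prob_not_expanding:
  assumes d: "d \<ge> 2" and "N > 0" and q: "q > 0"
    and \<delta>: "8 * real d * exp (- (3 * real N / (64 * real d * q))) \<le> \<delta>" "\<delta> \<le> 1"
  shows "measure_pmf.prob (design d N) {\<omega>. \<not> expanding q d (edge_weight d N \<omega>)} \<le> \<delta> / 2"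
proof -
  let ?V = "{..<d}"
  define K where "K = 3 * real N / (64 * real d * q)"
  define I where "I = {(T, S). S \<subseteq> T \<and> T \<subseteq> ?V \<and> S \<noteq> {} \<and>
    real (card T) < real d / 4 \<and> real (card T) \<le> q * real (card S)}"
  define J where "J = Sigma (Pow ?V - {{}}) Pow"
  have "I \<subseteq> J" by (auto simp: I_def J_def)
  have fJ: "finite J"
    unfolding J_def by (intro finite_SigmaI) (auto intro: finite_subset)
  have "{\<omega>. \<not> expanding q d (edge_weight d N \<omega>)} =
    {\<omega>. \<exists>(T, S)\<in>I. cut_weight (edge_weight d N \<omega>) S (?V - T) < real (card S) / 2}"
    by (auto simp: expanding_def I_def not_le)
  also have "measure_pmf.prob (design d N) \<dots> \<le> (\<Sum>(T, S)\<in>I. exp (- K) ^ card T)"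
    unfolding case_prod_unfold
  proof (rule prob_union_le, goal_cases)
    case 1
    show ?case using \<open>I \<subseteq> J\<close> fJ by (rule finite_subset)
  next
    case (2 TS)
    then obtain T S where TS: "TS = (T, S)" and *: "S \<subseteq> T" "T \<subseteq> ?V" "real (card T) < real d / 4"
      "real (card T) \<le> q * real (card S)" by (auto simp: I_def)
    let ?B = "?V - T"
    have "real (card ?B) = real d - real (card T)"
      using *(2) card_mono[OF _ *(2)] by (simp add: card_Diff_subset finite_subset of_nat_diff)
    then have cB: "3 / 4 * real d \<le> real (card ?B)" using *(3) by linarith
    then have ab: "real (card S) * (3 / 4 * real d) \<le> real (card S) * real (card ?B)"
      by (rule mult_left_mono) simp
    \<comment> \<open>The outside of \<open>T\<close> has at least three quarters of the vertices,
      and \<open>3 / 4 * 3 / 4 = 9 / 16\<close> exceeds one half.\<close>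
    have "real (card S) / 2 \<le> 3 / 4 * (real (card S) * (3 / 4 * real d) / real d)"
      using d by simp
    also have "\<dots> \<le> 3 / 4 * (real (card S) * real (card ?B) / real d)"
      by (intro mult_left_mono divide_right_mono ab) auto
    finally have half: "real (card S) / 2 \<le> 3 / 4 * (real (card S) * real (card ?B) / real d)" .
    have "measure_pmf.prob (design d N) {\<omega>. cut_weight (edge_weight d N \<omega>) S ?B < real (card S) / 2}
      \<le> measure_pmf.prob (design d N)
          {\<omega>. cut_weight (edge_weight d N \<omega>) S ?B < 3 / 4 * (real (card S) * real (card ?B) / real d)}"
      using half by (intro measure_pmf.finite_measure_mono) auto
    also have "\<dots> \<le> exp (- (real N * (real (card S) * real (card ?B)) / (16 * (real d)\<^sup>2)))"
      using * d \<open>N > 0\<close> by (intro prob_cut_weight_less) auto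
    also have "\<dots> \<le> exp (- (real N * (real (card S) * (3 / 4 * real d)) / (16 * (real d)\<^sup>2)))"
      unfolding exp_le_cancel_iff neg_le_iff_le by (intro divide_right_mono mult_left_mono ab) auto
    also have "real N * (real (card S) * (3 / 4 * real d)) / (16 * (real d)\<^sup>2) = K * (q * real (card S))"
      using d q by (simp add: K_def field_simps power2_eq_square)
    also have "exp (- (K * (q * real (card S)))) \<le> exp (- (K * real (card T)))"
      unfolding exp_le_cancel_iff neg_le_iff_le using q by (intro mult_left_mono *(4)) (simp add: K_def)
    also have "\<dots> = exp (- K) ^ card T"
      by (simp add: exp_of_nat_mult[symmetric] mult.commute)
    finally show ?case by (simp add: TS)
  qed
  \<comment> \<open>Dropping the size conditions lets the sum over \<open>S\<close> become a factor
    \<open>2 ^ card T\<close> and the sum over \<open>T\<close> a binomial expansion.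
    \<open>J\<close> still omits the empty \<open>T\<close>, whose term 1 would ruin the bound; this
    is the later \<open>- 1\<close>.\<close>
  also have "\<dots> \<le> (\<Sum>(T, S)\<in>J. exp (- K) ^ card T)"
    using \<open>I \<subseteq> J\<close> fJ by (intro sum_mono2) auto
  also have "\<dots> = (\<Sum>T\<in>Pow ?V - {{}}. \<Sum>S\<in>Pow T. exp (- K) ^ card T)"
    unfolding J_def by (rule sum.Sigma[symmetric]) (auto intro: finite_subset)
  also have "\<dots> = (\<Sum>T\<in>Pow ?V - {{}}. (2 * exp (- K)) ^ card T)"
    by (intro sum.cong refl) (auto simp: card_Pow finite_subset power_mult_distrib)
  also have "\<dots> = (1 + 2 * exp (- K)) ^ d - 1"
    using sum_power_card_Pow[of ?V "2 * exp (- K)"] by (simp add: sum_diff1)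
  also have "(1 + 2 * exp (- K)) ^ d \<le> exp (2 * exp (- K)) ^ d"
    by (intro power_mono exp_ge_add_one_self) (simp add: add_nonneg_nonneg)
  also have "\<dots> = exp (2 * real d * exp (- K))"
    by (simp add: exp_of_nat_mult[symmetric] mult_ac)
  also have "\<dots> \<le> exp (\<delta> / 4)"
    using \<delta>(1) by (simp add: K_def)
  also have "\<delta> \<ge> 0" using \<delta>(1) by (rule order_trans[rotated]) simp
  then have "exp (\<delta> / 4) \<le> 1 + \<delta> / 4 + (\<delta> / 4)\<^sup>2"
    using \<delta>(2) by (intro exp_bound) auto
  also have "(\<delta> / 4)\<^sup>2 \<le> \<delta> / 4"
    using \<open>\<delta> \<ge> 0\<close> \<delta>(2) by (simp add: power2_eq_square mult_mono[of \<delta> \<delta> \<delta> 4])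
  finally show ?thesis by simp
qed

text \<open>Union bound over at most \<open>2 ^ d * 2 ^ d\<close> pairs of subsets, each with a tail
  controlled by the lower bound \<open>m\<close> on the product of sizes.\<close>

lemma prob_not_dense_cuts:
  assumes d: "d \<ge> 2" and "N > 0"
  shows "measure_pmf.prob (design d N) {\<omega>. \<not> dense_cuts m d (edge_weight d N \<omega>)}
     \<le> 4 ^ d * exp (- (real N * m / (16 * (real d)\<^sup>2)))"
proof -
  let ?V = "{..<d}"
  define I where "I = {(A, B). A \<subseteq> ?V \<and> B \<subseteq> ?V \<and> A \<inter> B = {} \<and> m \<le> real (card A) * real (card B)}"
  have I: "I \<subseteq> Pow ?V \<times> Pow ?V" by (auto simp: I_def)
  have "{\<omega>. \<not> dense_cuts m d (edge_weight d N \<omega>)} =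
    {\<omega>. \<exists>(A, B)\<in>I. cut_weight (edge_weight d N \<omega>) A B
      < 3 / 4 * (real (card A) * real (card B) / real d)}"
    by (auto simp: dense_cuts_def I_def not_le)
  also have "measure_pmf.prob (design d N) \<dots> \<le> (\<Sum>(A, B)\<in>I. exp (- (real N * m / (16 * (real d)\<^sup>2))))"
    unfolding case_prod_unfold
  proof (rule prob_union_le, goal_cases)
    case 1
    show ?case using I by (rule finite_subset) simp
  next
    case (2 AB)
    then have *: "fst AB \<subseteq> ?V" "snd AB \<subseteq> ?V" "fst AB \<inter> snd AB = {}"
      "m \<le> real (card (fst AB)) * real (card (snd AB))"
      by (auto simp: I_def)
    show ?case
      by (rule order_trans[OF prob_cut_weight_less[OF *(1-3) d \<open>N > 0\<close>]])
        (use *(4) in \<open>simp add: divide_right_mono mult_left_mono\<close>)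
  qed
  also have "\<dots> = real (card I) * exp (- (real N * m / (16 * (real d)\<^sup>2)))"
    by (simp add: case_prod_unfold)
  also have "card I \<le> card (Pow ?V \<times> Pow ?V)" using I by (intro card_mono) auto
  then have "real (card I) \<le> 4 ^ d"
    by (simp add: card_cartesian_product card_Pow power_mult_distrib[symmetric])
  then have "real (card I) * exp (- (real N * m / (16 * (real d)\<^sup>2))) \<le> 4 ^ d * exp (- (real N * m / (16 * (real d)\<^sup>2)))"
    by (rule mult_right_mono) simp
  finally show ?thesis .
qed

section \<open>The numerical consequences of the sample size\<close>

text \<open>With \<open>M\<close> the logarithmic factor, \<open>exp (- (2 * M))\<close> is the
  square of \<open>\<delta> / (d * L)\<close>. Both quantities are bounded through it, the second
  after its exponent has also absorbed \<open>4 ^ d\<close>.\<close>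

lemma sample_size_bounds:
  fixes \<delta> :: real and L d N :: nat
  defines "q \<equiv> real d powr (1 / (real L - 1))"
  assumes \<delta>: "0 < \<delta>" "\<delta> < 1 / 10" and L: "2 \<le> L" and d: "3 \<le> d"
    and N: "1000 * ((real L)\<^sup>2 * real d powr (real L / (real L - 1)) * ln (real d * real L / \<delta>)) \<le> real N"
  shows "8 * real d * exp (- (3 * real N / (64 * real d * q))) \<le> \<delta>" (is ?expand)
    and "4 ^ d * exp (- (real N * ((real d)\<^sup>2 / (24 * real L)) / (16 * (real d)\<^sup>2))) \<le> \<delta> / 2" (is ?dense)
    and "N > 0"
proof -
  define M where "M = ln (real d * real L / \<delta>)"
  have dL: "6 \<le> real d * real L" using mult_mono[of 3 "real d" 2 "real L"] L d by simp
  then have "6 / \<delta> \<le> real d * real L / \<delta>" using \<delta> by (intro divide_right_mono) auto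
  moreover have "60 \<le> 6 / \<delta>" using \<delta> by (simp add: field_simps)
  ultimately have eM: "exp M = real d * real L / \<delta>" "60 \<le> exp M"
    using \<delta> by (auto simp: M_def)
  then have "M > 0" using exp_le_one_iff[of M] by linarith
  have q: "q \<ge> 1" unfolding q_def using L d by (intro ge_one_powr_ge_zero) auto
  \<comment> \<open>Splitting the exponent exposes the growth factor \<open>q\<close>: the power of
    \<open>d\<close> in the sample size is \<open>d * q\<close>.\<close>
  have "real L / (real L - 1) = 1 + 1 / (real L - 1)" using L by (simp add: field_simps)
  then have "real d powr (real L / (real L - 1)) = real d * q"
    using d by (simp add: q_def powr_add)
  with N have N: "1000 * ((real L)\<^sup>2 * (real d * q) * M) \<le> real N" by (simp add: M_def)
  have "0 < 1000 * ((real L)\<^sup>2 * (real d * q) * M)" using L d q \<open>M > 0\<close> by simp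
  with N show "N > 0" by linarith
  have small: "exp (- (2 * M)) = (\<delta> / (real d * real L))\<^sup>2"
  proof -
    have "exp (- (2 * M)) = inverse ((exp M)\<^sup>2)" by (simp add: exp_minus exp_double)
    then show ?thesis unfolding eM by (simp add: power_divide)
  qed
  have L2: "4 \<le> (real L)\<^sup>2" using power_mono[of 2 "real L" 2] L by simp
  show ?expand
  proof -
    have "2 * M \<le> 3 * (1000 * ((real L)\<^sup>2 * (real d * q) * M)) / (64 * real d * q)"
      using mult_right_mono[OF L2, of M] \<open>M > 0\<close> d q by (simp add: field_simps)
    also have "\<dots> \<le> 3 * real N / (64 * real d * q)"
      using q by (intro divide_right_mono mult_left_mono N) auto
    finally have "8 * real d * exp (- (3 * real N / (64 * real d * q))) \<le> 8 * real d * exp (- (2 * M))"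
      by (intro mult_left_mono) auto
    also have "\<dots> = \<delta> * (8 * \<delta> / (real d * (real L)\<^sup>2))"
      unfolding small using d L by (simp add: power2_eq_square field_simps)
    also have "\<dots> \<le> \<delta> * 1"
    proof (rule mult_left_mono)
      have "1 * 1 \<le> real d * (real L)\<^sup>2" using d L2 by (intro mult_mono) auto
      then show "8 * \<delta> / (real d * (real L)\<^sup>2) \<le> 1" using \<delta> by (simp add: divide_le_eq)
    qed (use \<delta> in simp)
    finally show ?thesis by simp
  qed
  show ?dense
  proof -
    \<comment> \<open>Here \<open>384 = 24 * 16\<close>, and \<open>L * q \<ge> 2\<close> gives a
      factor \<open>2000 / 384 > 5\<close>. One of the five copies of \<open>d * M\<close> pays for
      \<open>4 ^ d\<close>, since \<open>4 \<le> exp M\<close>; four remain.\<close>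
    have "real d * M * 5 \<le> (real L * q) * (real d * M) * 1000 / 384"
    proof -
      have "2 * 1 \<le> real L * q" using L q by (intro mult_mono) auto
      then have "2 * (real d * M) \<le> (real L * q) * (real d * M)"
        using \<open>M > 0\<close> by (intro mult_right_mono) auto
      moreover have "0 \<le> real d * M" using \<open>M > 0\<close> by simp
      ultimately show ?thesis by linarith
    qed
    also have "\<dots> = 1000 * ((real L)\<^sup>2 * (real d * q) * M) / (384 * real L)"
      using L by (simp add: power2_eq_square field_simps)
    also have "\<dots> \<le> real N / (384 * real L)"
      using N by (intro divide_right_mono) auto
    also have "\<dots> = real N * ((real d)\<^sup>2 / (24 * real L)) / (16 * (real d)\<^sup>2)"
      using d L by (simp add: field_simps)
    finally have "4 ^ d * exp (- (real N * ((real d)\<^sup>2 / (24 * real L)) / (16 * (real d)\<^sup>2)))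
        \<le> exp M ^ d * exp (- (real d * M * 5))"
      using eM(2) by (intro mult_mono power_mono) auto
    also have "\<dots> = exp (- (4 * real d * M))"
      by (simp add: exp_of_nat_mult[symmetric] exp_add[symmetric] algebra_simps)
    also have "\<dots> \<le> exp (- (2 * M))"
      using \<open>M > 0\<close> d by simp
    also have "\<dots> = \<delta> * (\<delta> / (real d * real L)\<^sup>2)"
      unfolding small by (simp add: power2_eq_square)
    also have "\<dots> \<le> \<delta> * (1 / 2)"
    proof (rule mult_left_mono)
      have "1 \<le> (real d * real L)\<^sup>2" using dL by simp
      then show "\<delta> / (real d * real L)\<^sup>2 \<le> 1 / 2" using \<delta> by (simp add: divide_le_eq)
    qed (use \<delta> in simp)
    finally show ?thesis by simp
  qed
qed

section \<open>From good designs to the probability bound\<close>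

lemma expanding_dense_design_gain:
  assumes \<omega>: "\<And>r. r < N \<Longrightarrow> \<omega> r \<in> pairs d"
    and L: "L \<ge> 2" and d: "d \<ge> 2"
    and good: "expanding (real d powr (1 / (real L - 1))) d (edge_weight d N \<omega>)"
      "dense_cuts ((real d)\<^sup>2 / (24 * real L)) d (edge_weight d N \<omega>)"
  shows "1 / (2 * real L) \<le> linf_min_gain d (\<lambda>u. sample_cov d N \<omega> *\<^sub>v u)"
    and "linf_opnorm d (pseudoinverse d (\<lambda>u. sample_cov d N \<omega> *\<^sub>v u)) \<le> 2 * real L"
proof -
  let ?q = "real d powr (1 / (real L - 1))"
  have q: "?q > 0" using d by simp
  \<comment> \<open>With this choice, \<open>L - 1\<close> growth steps starting from one vertex
    reach \<open>d\<close>, hence certainly the required \<open>d / 4\<close>.\<close>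
  have "?q ^ (L - 1) = real d"
    using L d by (simp add: powr_realpow[symmetric] powr_powr of_nat_diff)
  then have gain: "1 / (2 * real L) \<le> linf_norm (sample_cov d N \<omega> *\<^sub>v u)" if "u \<in> unit_centered d" for u
    using L d by (intro linf_norm_sample_cov_ge[where q = ?q] \<omega> q that
        good[unfolded expanding_def dense_cuts_def, rule_format]) auto
  then show "1 / (2 * real L) \<le> linf_min_gain d (\<lambda>u. sample_cov d N \<omega> *\<^sub>v u)"
    unfolding linf_min_gain_def by (intro cINF_greatest unit_centered_nonempty d)
  show "linf_opnorm d (pseudoinverse d (\<lambda>u. sample_cov d N \<omega> *\<^sub>v u)) \<le> 2 * real L"
    using L linf_opnorm_pseudoinverse_le[OF sample_cov_carrier d _
        sample_cov_mult_centered[where \<omega> = \<omega>, OF \<omega>] gain] by simp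
qed

theorem proposition2:
  shows "\<exists>C::real. C > 0 \<and>
    (\<forall>(\<delta>::real) (L::nat) (d::nat) (N::nat).
      0 < \<delta> \<longrightarrow> \<delta> < 1 / 10 \<longrightarrow> 2 \<le> L \<longrightarrow> 3 \<le> d \<longrightarrow> d \<le> N \<longrightarrow>
      real N \<ge> C * max ((real L)\<^sup>2 * real d powr (real L / (real L - 1)) * ln (real d * real L / \<delta>))
                        ((real L) ^ 3 * real d * ln (real L / \<delta>)) \<longrightarrow>
      measure_pmf.prob (design d N)
        {\<omega>. linf_min_gain d (\<lambda>u. sample_cov d N \<omega> *\<^sub>v u) \<ge> 1 / (2 * real L) \<and>
             linf_opnorm d (pseudoinverse d (\<lambda>u. sample_cov d N \<omega> *\<^sub>v u)) \<le> 2 * real L}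
      \<ge> 1 - \<delta>)"
proof (intro exI[of _ 1000] conjI allI impI)
  fix \<delta> :: real and L d N :: nat
  assume \<delta>: "0 < \<delta>" "\<delta> < 1 / 10" and L: "2 \<le> L" and d: "3 \<le> d" and "d \<le> N"
    and N: "real N \<ge> 1000 * max ((real L)\<^sup>2 * real d powr (real L / (real L - 1)) * ln (real d * real L / \<delta>))
                        ((real L) ^ 3 * real d * ln (real L / \<delta>))"
  let ?P = "design d N"
  let ?G = "{\<omega>. linf_min_gain d (\<lambda>u. sample_cov d N \<omega> *\<^sub>v u) \<ge> 1 / (2 * real L) \<and>
             linf_opnorm d (pseudoinverse d (\<lambda>u. sample_cov d N \<omega> *\<^sub>v u)) \<le> 2 * real L}"
  let ?B1 = "{\<omega>. \<not> expanding (real d powr (1 / (real L - 1))) d (edge_weight d N \<omega>)}"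
  let ?B2 = "{\<omega>. \<not> dense_cuts ((real d)\<^sup>2 / (24 * real L)) d (edge_weight d N \<omega>)}"
  have "1000 * ((real L)\<^sup>2 * real d powr (real L / (real L - 1)) * ln (real d * real L / \<delta>)) \<le> real N"
    by (rule order_trans[OF _ N]) simp
  note size = sample_size_bounds[OF \<delta> L d this]
  have "d \<ge> 2" using d by simp
  have B1: "measure_pmf.prob ?P ?B1 \<le> \<delta> / 2"
    using prob_not_expanding[OF \<open>d \<ge> 2\<close> size(3) _ size(1)] \<delta> d by simp
  have B2: "measure_pmf.prob ?P ?B2 \<le> \<delta> / 2"
    using order_trans[OF prob_not_dense_cuts[OF \<open>d \<ge> 2\<close> size(3)] size(2)] .
  have "(0, 1) \<in> pairs d" using d by (simp add: pairs_def)
  then have "set_pmf (pmf_of_set (pairs d)) = pairs d"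
    using finite_pairs[of d] by (subst set_pmf_of_set) auto
  then have pairs: "\<omega> r \<in> pairs d" if "\<omega> \<in> set_pmf ?P" "r < N" for \<omega> r
    using that by (auto simp: design_def set_Pi_pmf PiE_dflt_def)
  \<comment> \<open>The deterministic argument needs every observation to be a valid pair, which is
    guaranteed on the support. The support has probability 1, so covering it by the good event and
    two bad ones suffices.\<close>
  have "set_pmf ?P \<subseteq> ?G \<union> (?B1 \<union> ?B2)"
  proof
    fix \<omega> assume "\<omega> \<in> set_pmf ?P"
    then have "\<omega> r \<in> pairs d" if "r < N" for r using pairs that by blast
    then show "\<omega> \<in> ?G \<union> (?B1 \<union> ?B2)"
      using expanding_dense_design_gain[of N \<omega> d L] L \<open>d \<ge> 2\<close> by auto
  qed
  then have "measure_pmf.prob ?P (set_pmf ?P) \<le> measure_pmf.prob ?P (?G \<union> (?B1 \<union> ?B2))"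
    by (intro measure_pmf.finite_measure_mono) auto
  also have "\<dots> \<le> measure_pmf.prob ?P ?G + (measure_pmf.prob ?P ?B1 + measure_pmf.prob ?P ?B2)"
    by (intro order_trans[OF measure_Un_le] add_left_mono) auto
  also have "measure_pmf.prob ?P (set_pmf ?P) = 1"
    using measure_Int_set_pmf[of ?P UNIV] by simp
  finally show "1 - \<delta> \<le> measure_pmf.prob ?P ?G" using B1 B2 by linarith
qed simp

end
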